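(* Let $G=PSL_3(q)$, where $q$ is a prime power, and let $p$ be an odd prime dividing $|G|$. Then $w_p(G)=2$.
   Context: For a finite group $G$ and a prime $p$ dividing $|G|$, $I_p(G)$ denotes the set of elements of $G$ of order exactly $p$. The $p$-width $w_p(G)$ is the minimal $k\in\mathbb{N}$ such that every $g\in G$ can be written as a product of at most $k$ elements of $I_p(G)$. *)

theory Defs
  imports
    "HOL-Analysis.Determinants"
    "HOL-Algebra.Multiplicative_Group"
    "HOL-Library.Extended_Nat"
    "HOL-Computational_Algebra.Primes"
begin

definition SL :: "('a::field ^ 'n ^ 'n) monoid" where
  "SL = \<lparr>carrier = {A. det A = 1}, mult = (**), one = mat 1\<rparr>"

definition group_center :: "('g, 'b) monoid_scheme \<Rightarrow> 'g set" where
  "group_center G =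
     {z \<in> carrier G. \<forall>g \<in> carrier G. z \<otimes>\<^bsub>G\<^esub> g = g \<otimes>\<^bsub>G\<^esub> z}"

definition PSL :: "('a::field ^ 'n ^ 'n) set monoid" where
  "PSL = SL Mod group_center SL"

definition elements_of_order :: "nat \<Rightarrow> ('g, 'b) monoid_scheme \<Rightarrow> 'g set" where
  "elements_of_order p G = {x \<in> carrier G. group.ord G x = p}"

definition group_prod :: "('g, 'b) monoid_scheme \<Rightarrow> 'g list \<Rightarrow> 'g" where
  "group_prod G xs = foldr (\<otimes>\<^bsub>G\<^esub>) xs \<one>\<^bsub>G\<^esub>"

text \<open>The width is the least bound, and \<open>\<infinity>\<close> (the infimum of the empty set)
  if the elements of order \<open>p\<close> do not generate \<open>G\<close>.
  The empty product is admitted as a product of at most \<open>k\<close> elements.\<close>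

definition p_width :: "nat \<Rightarrow> ('g, 'b) monoid_scheme \<Rightarrow> enat" where
  "p_width p G = Inf {enat k | k. \<forall>g \<in> carrier G. \<exists>xs.
     set xs \<subseteq> elements_of_order p G \<and> length xs \<le> k \<and> group_prod G xs = g}"

lemma group_SL: "group (SL :: ('a::field ^ 'n ^ 'n) monoid)"
proof (rule groupI)
  fix A :: "'a ^ 'n ^ 'n"
  assume "A \<in> carrier SL"
  then have d: "det A = 1"
    by (simp add: SL_def)
  then have "invertible A"
    by (simp add: invertible_det_nz)
  then obtain B where B: "B ** A = mat 1"
    by (auto simp: invertible_def)
  then have "det B * det A = 1"
    by (metis det_I det_mul)
  with d B show "\<exists>B \<in> carrier SL. B \<otimes>\<^bsub>SL\<^esub> A = \<one>\<^bsub>SL\<^esub>"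
    by (auto simp: SL_def)
qed (auto simp: SL_def det_mul matrix_mul_assoc)

lemma (in group) group_center_normal: "group_center G \<lhd> G"
proof -
  have "subgroup (group_center G) G"
  proof (rule subgroupI)
    have "\<one> \<in> group_center G"
      by (simp add: group_center_def)
    then show "group_center G \<noteq> {}"
      by blast
  next
    fix a b assume a: "a \<in> group_center G" and b: "b \<in> group_center G"
    then have ab: "a \<in> carrier G" "b \<in> carrier G"
      by (simp_all add: group_center_def)
    have "a \<otimes> b \<otimes> g = g \<otimes> (a \<otimes> b)" if g: "g \<in> carrier G" for g
    proof -
      have ag: "a \<otimes> g = g \<otimes> a" and bg: "b \<otimes> g = g \<otimes> b"
        using a b g unfolding group_center_def by blast+
      have "a \<otimes> b \<otimes> g = a \<otimes> (g \<otimes> b)"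
        using ab g by (simp only: m_assoc bg)
      also have "\<dots> = (g \<otimes> a) \<otimes> b"
        using ab g by (simp only: m_assoc[symmetric] ag)
      also have "\<dots> = g \<otimes> (a \<otimes> b)"
        using ab g by (simp only: m_assoc)
      finally show ?thesis .
    qed
    with ab show "a \<otimes> b \<in> group_center G"
      by (simp add: group_center_def)
  next
    fix a assume a: "a \<in> group_center G"
    then have ac: "a \<in> carrier G"
      by (simp add: group_center_def)
    have "inv a \<otimes> g = g \<otimes> inv a" if g: "g \<in> carrier G" for g
    proof -
      have "a \<otimes> inv g = inv g \<otimes> a"
        using a g unfolding group_center_def by blast
      then have "inv (a \<otimes> inv g) = inv (inv g \<otimes> a)"
        by simp
      then show ?thesis
        using ac g by (simp add: inv_mult_group)
    qed
    with ac show "inv a \<in> group_center G"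
      by (simp add: group_center_def)
  qed (auto simp: group_center_def)
  moreover have "x \<otimes> h \<otimes> inv x \<in> group_center G"
    if x: "x \<in> carrier G" and h: "h \<in> group_center G" for x h
  proof -
    have hc: "h \<in> carrier G"
      using h by (simp add: group_center_def)
    have "x \<otimes> h = h \<otimes> x"
      using x h unfolding group_center_def by force
    then have "x \<otimes> h \<otimes> inv x = h"
      using x hc by (simp add: m_assoc)
    with h show ?thesis by simp
  qed
  ultimately show ?thesis
    by (simp add: normal_inv_iff)
qed

lemma group_PSL: "group (PSL :: ('a::field ^ 'n ^ 'n) set monoid)"
  unfolding PSL_def by (intro normal.factorgroup_is_group group.group_center_normal group_SL)

end

theory Submission
  imports Defs "HOL-Algebra.Sylow"
begin

text \<open>By Cauchy's theorem \<open>SL\<^sub>3\<close> contains a nonscalar matrix whose \<open>p\<close>-th power is scalar. From it one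
  obtains a polynomial \<open>f = x^3 - a x^2 + b x - 1\<close> such that every matrix with characteristic
  polynomial \<open>f\<close> or its reciprocal \<open>x^3 - b x^2 + a x - 1\<close> has \<open>p\<close>-th power \<open>1\<close>: the powers of a matrix
  reduce modulo \<open>f\<close> to combinations of \<open>B\<^sup>2\<close>, \<open>B\<close>, \<open>1\<close> which depend only on \<open>f\<close>. A nonscalar matrix of
  determinant one is either cyclic, hence similar to a companion matrix, or a rank one perturbation of
  a scalar matrix. In both cases it is, up to a central factor, a product \<open>B C\<close> where \<open>B\<close> has
  characteristic polynomial \<open>f\<close> and \<open>C\<close> has characteristic polynomial \<open>f\<close> or its reciprocal, and it
  suffices to exhibit one such product with the right invariants. The width is not one, because there
  is a noncentral involution and \<open>p\<close> is odd.\<close>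

subsection \<open>Three by three matrices\<close>

definition mat3 :: "'a \<Rightarrow> 'a \<Rightarrow> 'a \<Rightarrow> 'a \<Rightarrow> 'a \<Rightarrow> 'a \<Rightarrow> 'a \<Rightarrow> 'a \<Rightarrow> 'a \<Rightarrow> 'a::field ^ 3 ^ 3" where
  "mat3 a b c d e f g h i = vector [vector [a, b, c], vector [d, e, f], vector [g, h, i]]"

text \<open>The coefficient of \<open>x\<close> in the characteristic polynomial
  \<open>x^3 - trace A x^2 + sum_minors A x - det A\<close>.\<close>

definition sum_minors :: "'a::field ^ 3 ^ 3 \<Rightarrow> 'a" where
  "sum_minors A = A$1$1 * A$2$2 - A$1$2 * A$2$1 + A$1$1 * A$3$3 - A$1$3 * A$3$1
     + A$2$2 * A$3$3 - A$2$3 * A$3$2"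

lemma mat3_exhaust:
  obtains a b c d e f g h i where "A = mat3 a b c d e f g h i"
proof
  show "A = mat3 (A$1$1) (A$1$2) (A$1$3) (A$2$1) (A$2$2) (A$2$3) (A$3$1) (A$3$2) (A$3$3)"
    by (simp add: mat3_def vec_eq_iff forall_3)
qed

lemma mat3_eq_iff:
  "mat3 a b c d e f g h i = mat3 a' b' c' d' e' f' g' h' i' \<longleftrightarrow>
     a = a' \<and> b = b' \<and> c = c' \<and> d = d' \<and> e = e' \<and> f = f' \<and> g = g' \<and> h = h' \<and> i = i'"
  by (auto simp: mat3_def vec_eq_iff forall_3)

lemma mat3_mult:
  "mat3 a b c d e f g h i ** mat3 a' b' c' d' e' f' g' h' i' =
     mat3 (a * a' + b * d' + c * g') (a * b' + b * e' + c * h') (a * c' + b * f' + c * i')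
       (d * a' + e * d' + f * g') (d * b' + e * e' + f * h') (d * c' + e * f' + f * i')
       (g * a' + h * d' + i * g') (g * b' + h * e' + i * h') (g * c' + h * f' + i * i')"
  by (simp add: mat3_def vec_eq_iff forall_3 matrix_matrix_mult_def sum_3)

lemma mat3_add:
  "mat3 a b c d e f g h i + mat3 a' b' c' d' e' f' g' h' i' =
     mat3 (a + a') (b + b') (c + c') (d + d') (e + e') (f + f') (g + g') (h + h') (i + i')"
  by (simp add: mat3_def vec_eq_iff forall_3)

lemma mat3_diff:
  "mat3 a b c d e f g h i - mat3 a' b' c' d' e' f' g' h' i' =
     mat3 (a - a') (b - b') (c - c') (d - d') (e - e') (f - f') (g - g') (h - h') (i - i')"
  by (simp add: mat3_def vec_eq_iff forall_3)

lemma mat_eq_mat3: "mat k = mat3 k 0 0 0 k 0 0 0 k"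
  by (simp add: mat3_def mat_def vec_eq_iff forall_3)

lemma det_mat3:
  "det (mat3 a b c d e f g h i) =
     a * e * i + b * f * g + c * d * h - a * f * h - b * d * i - c * e * g"
  by (simp add: mat3_def det_3)

lemma trace_mat3: "trace (mat3 a b c d e f g h i) = a + e + i"
  by (simp add: mat3_def trace_def sum_3)

lemma sum_minors_mat3:
  "sum_minors (mat3 a b c d e f g h i) = a * e - b * d + a * i - c * g + e * i - f * h"
  by (simp add: mat3_def sum_minors_def)

lemmas mat3_simps = mat3_eq_iff mat3_mult mat3_add mat3_diff mat_eq_mat3 det_mat3 trace_mat3
  sum_minors_mat3

text \<open>Evaluating the characteristic polynomial at \<open>1\<close> expresses
  \<open>sum_minors\<close> by determinants and the trace, whose invariance under similarity is
  easy.\<close>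

lemma sum_minors_det:
  "sum_minors A = det (mat 1 - A) + trace A + det A - 1" for A :: "'a::field ^ 3 ^ 3"
  by (cases A rule: mat3_exhaust) (simp add: mat3_simps algebra_simps)

lemma cayley_hamilton_3:
  fixes A :: "'a::field ^ 3 ^ 3"
  shows "A ** (A ** A) = mat (trace A) ** (A ** A) - mat (sum_minors A) ** A + mat (det A)"
  by (cases A rule: mat3_exhaust) (simp add: mat3_simps algebra_simps)

lemma mat_mult_nth:
  fixes A :: "'a::field ^ 'n ^ 'n"
  shows "(mat k ** A) $ i $ j = k * A $ i $ j" "(A ** mat k) $ i $ j = k * A $ i $ j"
  by (simp_all add: matrix_matrix_mult_def mat_def if_distrib if_distribR
      sum.delta sum.delta' mult.commute cong: if_cong)

lemma mat_commute: "mat k ** A = A ** mat k" for A :: "'a::field ^ 'n ^ 'n"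
  by (simp add: vec_eq_iff mat_mult_nth)

lemma mat_mult_mat: "mat k ** mat l = (mat (k * l) :: 'a::field ^ 'n ^ 'n)"
  by (simp add: vec_eq_iff mat_mult_nth) (simp add: mat_def)

lemma matrix_mult_diff:
  fixes A B C :: "'a::field ^ 'n ^ 'n"
  shows "A ** (B - C) = A ** B - A ** C" "(B - C) ** A = B ** A - C ** A"
  by (simp_all add: vec_eq_iff matrix_matrix_mult_def algebra_simps sum_subtractf)

lemma matrix_mult_add:
  fixes A B C :: "'a::field ^ 'n ^ 'n"
  shows "A ** (B + C) = A ** B + A ** C" "(B + C) ** A = B ** A + C ** A"
  by (simp_all add: vec_eq_iff matrix_matrix_mult_def algebra_simps sum.distrib)

primrec mpow :: "'a::field ^ 'n ^ 'n \<Rightarrow> nat \<Rightarrow> 'a ^ 'n ^ 'n" where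
  "mpow A 0 = mat 1"
| "mpow A (Suc n) = mpow A n ** A"

lemma mpow_mult_commute:
  assumes AB: "A ** B = B ** A"
  shows "mpow (A ** B) n = mpow A n ** mpow B n"
proof (induction n)
  case (Suc n)
  have c: "mpow B n ** A = A ** mpow B n" for n
  proof (induction n)
    case (Suc n)
    have "mpow B (Suc n) ** A = (mpow B n ** A) ** B"
      using AB by (simp flip: matrix_mul_assoc)
    then show ?case
      by (simp add: Suc matrix_mul_assoc)
  qed simp
  have "mpow (A ** B) (Suc n) = mpow A n ** (mpow B n ** A) ** B"
    by (simp add: Suc matrix_mul_assoc)
  then show ?case
    by (simp add: c matrix_mul_assoc)
qed simp

lemma mpow_mat: "mpow (mat k) n = mat (k ^ n)"
  by (induction n) (simp_all add: mat_mult_mat mult.commute)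

subsection \<open>Similarity\<close>

definition similar_mat :: "'a::field ^ 'n ^ 'n \<Rightarrow> 'a ^ 'n ^ 'n \<Rightarrow> bool" where
  "similar_mat A B \<longleftrightarrow> (\<exists>P Q. P ** Q = mat 1 \<and> Q ** P = mat 1 \<and> A = P ** B ** Q)"

lemma similar_matI:
  assumes "det P \<noteq> 0" "A ** P = P ** B"
  shows "similar_mat A B"
proof -
  from assms(1) obtain Q where Q: "P ** Q = mat 1" "Q ** P = mat 1"
    by (metis invertible_def invertible_det_nz)
  have "A = P ** B ** Q"
    by (metis Q(1) assms(2) matrix_mul_assoc matrix_mul_rid)
  with Q show ?thesis
    unfolding similar_mat_def by blast
qed

lemma similar_mat_sym: "similar_mat A B \<Longrightarrow> similar_mat B A"
  unfolding similar_mat_def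
  by (metis matrix_mul_assoc matrix_mul_lid matrix_mul_rid)

lemma similar_mat_trans:
  assumes "similar_mat A B" "similar_mat B C"
  shows "similar_mat A C"
proof -
  obtain P Q where 1: "P ** Q = mat 1" "Q ** P = mat 1" "A = P ** B ** Q"
    using assms(1) unfolding similar_mat_def by blast
  obtain R S where 2: "R ** S = mat 1" "S ** R = mat 1" "B = R ** C ** S"
    using assms(2) unfolding similar_mat_def by blast
  have "(P ** R) ** (S ** Q) = mat 1" "(S ** Q) ** (P ** R) = mat 1"
    by (metis 1 2 matrix_mul_assoc matrix_mul_lid)+
  moreover have "A = (P ** R) ** C ** (S ** Q)"
    using 1 2 by (simp add: matrix_mul_assoc)
  ultimately show ?thesis
    unfolding similar_mat_def by blast
qed

lemma similar_mat_det:
  assumes "similar_mat A B"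
  shows "det A = det B"
proof -
  obtain P Q where 1: "P ** Q = mat 1" "A = P ** B ** Q"
    using assms unfolding similar_mat_def by blast
  have "det P * det Q = 1"
    by (metis 1(1) det_I det_mul)
  then show ?thesis
    by (simp add: 1(2) det_mul mult_ac)
qed

lemma similar_mat_trace:
  assumes "similar_mat A B"
  shows "trace A = trace B"
proof -
  obtain P Q where 1: "Q ** P = mat 1" "A = P ** B ** Q"
    using assms unfolding similar_mat_def by blast
  have "trace A = trace (Q ** (P ** B))"
    unfolding 1(2) by (rule trace_mul_sym)
  then show ?thesis
    by (simp add: 1(1) matrix_mul_assoc)
qed

lemma similar_mat_diff_mat:
  assumes "similar_mat A B"
  shows "similar_mat (A - mat k) (B - mat k)"
proof -
  obtain P Q where 1: "P ** Q = mat 1" "Q ** P = mat 1" "A = P ** B ** Q"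
    using assms unfolding similar_mat_def by blast
  have "P ** mat k ** Q = mat k"
    by (metis 1(1) mat_commute matrix_mul_assoc matrix_mul_rid)
  then have "A - mat k = P ** (B - mat k) ** Q"
    by (simp add: 1(3) matrix_mult_diff)
  with 1 show ?thesis
    unfolding similar_mat_def by blast
qed

lemma similar_mat_sum_minors:
  fixes A B :: "'a::field ^ 3 ^ 3"
  assumes "similar_mat A B"
  shows "sum_minors A = sum_minors B"
proof -
  have "det (mat 1 - A) = - det (A - mat 1)" for A :: "'a ^ 3 ^ 3"
    by (cases A rule: mat3_exhaust) (simp add: mat3_simps algebra_simps)
  then show ?thesis
    using assms similar_mat_det[OF similar_mat_diff_mat[OF assms, of 1]]
    by (simp add: sum_minors_det similar_mat_det similar_mat_trace)
qed

lemma similar_mat_mpow: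
  assumes "similar_mat A B"
  shows "similar_mat (mpow A n) (mpow B n)"
proof -
  obtain P Q where 1: "P ** Q = mat 1" "Q ** P = mat 1" "A = P ** B ** Q"
    using assms unfolding similar_mat_def by blast
  have "mpow A n = P ** mpow B n ** Q"
  proof (induction n)
    case (Suc n)
    have "P ** mpow B n ** Q ** (P ** B ** Q) = P ** mpow B n ** (Q ** P) ** B ** Q"
      by (simp add: matrix_mul_assoc)
    then show ?case
      using Suc by (simp add: 1 matrix_mul_assoc)
  qed (simp add: 1)
  with 1 show ?thesis
    unfolding similar_mat_def by blast
qed

lemma similar_mat_mat: "similar_mat A (mat k) \<Longrightarrow> A = mat k"
  unfolding similar_mat_def by (metis mat_commute matrix_mul_assoc matrix_mul_rid)

text \<open>Conjugating a product conjugates both factors. Hence it suffices to factorise one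
  representative of each similarity class.\<close>

lemma similar_mat_mult:
  assumes "similar_mat A (B ** C)"
  obtains B' C' where "A = B' ** C'" "similar_mat B' B" "similar_mat C' C"
proof -
  obtain P Q where 1: "P ** Q = mat 1" "Q ** P = mat 1" "A = P ** (B ** C) ** Q"
    using assms unfolding similar_mat_def by blast
  have "P ** B ** Q ** (P ** C ** Q) = P ** B ** (Q ** P) ** C ** Q"
    by (simp add: matrix_mul_assoc)
  then have "A = (P ** B ** Q) ** (P ** C ** Q)"
    by (simp add: 1 matrix_mul_assoc)
  moreover have "similar_mat (P ** B ** Q) B" "similar_mat (P ** C ** Q) C"
    using 1 unfolding similar_mat_def by blast+
  ultimately show ?thesis
    using that by blast
qed

subsection \<open>Normal forms of nonscalar matrices\<close>

text \<open>The characteristic polynomial of \<open>companion s r\<close> is \<open>x^3 - s x^2 + r x - 1\<close>. The predicate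
  \<open>near_scalar A l\<close> says that \<open>A - l\<close> has rank at most one, and \<open>reflection_form l\<close> is the nonscalar
  matrix of determinant one with this property, up to similarity.\<close>

definition companion :: "'a::field \<Rightarrow> 'a \<Rightarrow> 'a ^ 3 ^ 3" where
  "companion s r = mat3 0 0 1 1 0 (- r) 0 1 s"

definition near_scalar :: "'a::field ^ 3 ^ 3 \<Rightarrow> 'a \<Rightarrow> bool" where
  "near_scalar A l \<longleftrightarrow> (\<exists>U V. A - mat l = U ** mat3 1 0 0 0 0 0 0 0 0 ** V)"

definition reflection_form :: "'a::field \<Rightarrow> 'a ^ 3 ^ 3" where
  "reflection_form l = mat3 0 (- 1 / l) 0 1 (l + 1 / l\<^sup>2) 0 0 0 l"

definition columns3 :: "'a::field ^ 3 \<Rightarrow> 'a ^ 3 \<Rightarrow> 'a ^ 3 \<Rightarrow> 'a ^ 3 ^ 3" where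
  "columns3 u v w = mat3 (u$1) (v$1) (w$1) (u$2) (v$2) (w$2) (u$3) (v$3) (w$3)"

lemma mat3_vector_mult:
  "mat3 a b c d e f g h i *v vector [x, y, z] =
     vector [a * x + b * y + c * z, d * x + e * y + f * z, g * x + h * y + i * z]"
  by (simp add: mat3_def vec_eq_iff forall_3 matrix_vector_mult_def sum_3)

lemma mat_vector_mult: "mat k *v x = k *s x" for x :: "'a::field ^ 'n"
  by (simp add: vec_eq_iff matrix_vector_mult_def mat_def if_distrib if_distribR
      sum.delta sum.delta' cong: if_cong)

lemma mult_columns3: "A ** columns3 u v w = columns3 (A *v u) (A *v v) (A *v w)"
  by (simp add: vec_eq_iff forall_3 columns3_def mat3_def matrix_matrix_mult_def
      matrix_vector_mult_def sum_3)

text \<open>The hypothesis makes \<open>v\<close> a cyclic vector. In the basis \<open>v\<close>,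
  \<open>A v\<close>, \<open>A (A v)\<close> the first two columns are shifts, and Cayley-Hamilton
  gives the third.\<close>

lemma similar_companion:
  fixes A :: "'a::field ^ 3 ^ 3"
  assumes "det A = 1" and "det (columns3 v (A *v v) (A *v (A *v v))) \<noteq> 0"
  shows "similar_mat A (companion (trace A) (sum_minors A))"
proof (rule similar_matI[OF assms(2)])
  have "A *v (A *v (A *v v)) = (A ** (A ** A)) *v v"
    by (simp add: matrix_vector_mul_assoc)
  also have "\<dots> = trace A *s (A *v (A *v v)) - sum_minors A *s (A *v v) + v"
    unfolding cayley_hamilton_3 assms(1)
    by (simp add: matrix_vector_mult_add_rdistrib matrix_vector_mult_diff_rdistrib
        mat_vector_mult flip: matrix_vector_mul_assoc)
  finally have A3: "A *v (A *v (A *v v)) =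
    trace A *s (A *v (A *v v)) - sum_minors A *s (A *v v) + v" .
  show "A ** columns3 v (A *v v) (A *v (A *v v)) =
    columns3 v (A *v v) (A *v (A *v v)) ** companion (trace A) (sum_minors A)"
    unfolding mult_columns3 A3 by (simp add: columns3_def companion_def mat3_simps algebra_simps)
qed

lemma similar_near_scalar:
  assumes "similar_mat A B" "near_scalar B l"
  shows "near_scalar A l"
proof -
  obtain P Q where 1: "A - mat l = P ** (B - mat l) ** Q"
    using similar_mat_diff_mat[OF assms(1), of l] unfolding similar_mat_def by blast
  obtain U V where "B - mat l = U ** mat3 1 0 0 0 0 0 0 0 0 ** V"
    using assms(2) unfolding near_scalar_def by blast
  then have "A - mat l = (P ** U) ** mat3 1 0 0 0 0 0 0 0 0 ** (V ** Q)"
    by (simp add: 1 matrix_mul_assoc)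
  then show ?thesis
    unfolding near_scalar_def by blast
qed

lemma near_scalarI:
  assumes "A - mat l = mat3 (u1 * v1) (u1 * v2) (u1 * v3) (u2 * v1) (u2 * v2) (u2 * v3)
    (u3 * v1) (u3 * v2) (u3 * v3)"
  shows "near_scalar A l"
proof -
  have "A - mat l = mat3 u1 0 0 u2 0 0 u3 0 0 ** mat3 1 0 0 0 0 0 0 0 0 ** mat3 v1 v2 v3 0 0 0 0 0 0"
    unfolding assms by (simp add: mat3_simps)
  then show ?thesis
    unfolding near_scalar_def by blast
qed

text \<open>A matrix of rank at most one is a column times a row, so its 2 by 2 minors vanish. One
  of these equations often suffices later to refute \<open>near_scalar\<close>.\<close>

lemma near_scalar_minors:
  assumes "near_scalar (mat3 a b c d e f g h i) l"
  shows "(a - l) * (e - l) = b * d" "(a - l) * h = b * g" "d * h = (e - l) * g"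
    "d * (i - l) = f * g" "(a - l) * (i - l) = c * g" "(e - l) * (i - l) = f * h"
    "b * f = c * (e - l)"
proof -
  obtain U V where UV: "mat3 a b c d e f g h i - mat l = U ** mat3 1 0 0 0 0 0 0 0 0 ** V"
    using assms unfolding near_scalar_def by blast
  obtain u1 b1 c1 u2 e1 f1 u3 h1 i1 where U: "U = mat3 u1 b1 c1 u2 e1 f1 u3 h1 i1"
    using mat3_exhaust by blast
  obtain v1 v2 v3 b2 c2 e2 f2 h2 i2 where V: "V = mat3 v1 v2 v3 b2 c2 e2 f2 h2 i2"
    using mat3_exhaust by blast
  have e: "a - l = u1 * v1" "b = u1 * v2" "c = u1 * v3" "d = u2 * v1" "e - l = u2 * v2"
    "f = u2 * v3" "g = u3 * v1" "h = u3 * v2" "i - l = u3 * v3"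
    using UV unfolding U V by (simp_all add: mat3_simps)
  show "(a - l) * (e - l) = b * d" "(a - l) * h = b * g" "d * h = (e - l) * g"
    "d * (i - l) = f * g" "(a - l) * (i - l) = c * g" "(e - l) * (i - l) = f * h"
    "b * f = c * (e - l)"
    unfolding e by simp_all
qed

lemma not_near_scalar_companion: "\<not> near_scalar (companion s r) l"
  unfolding companion_def by (auto dest: near_scalar_minors(3))

lemma near_scalar_reflection_form:
  assumes "l \<noteq> 0"
  shows "near_scalar (reflection_form l) m \<longleftrightarrow> m = l"
proof
  assume "near_scalar (reflection_form l) m"
  then show "m = l"
    unfolding reflection_form_def by (auto dest: near_scalar_minors(4))
next
  show "near_scalar (reflection_form l) m" if "m = l"
    by (rule near_scalarI[of _ _ "- l" 1 "1 / l\<^sup>2" 0 1 0])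
      (use assms in \<open>simp add: that reflection_form_def mat3_simps power2_eq_square\<close>)
qed

text \<open>If every vector were an eigenvector, the unit vectors would make \<open>A\<close>
  diagonal, and \<open>e1 + e2\<close> and \<open>e1 + e3\<close> would make its diagonal entries
  equal.\<close>

lemma nonscalar_noneigenvector:
  fixes A :: "'a::field ^ 3 ^ 3"
  assumes "\<And>k. A \<noteq> mat k"
  obtains v w where "det (columns3 v (A *v v) w) \<noteq> 0"
proof (rule ccontr)
  assume "\<not> thesis"
  then have 0: "det (columns3 v (A *v v) w) = 0" for v w
    using that by blast
  obtain a b c d e f g h i where A: "A = mat3 a b c d e f g h i"
    using mat3_exhaust by blast
  note D = columns3_def mat3_vector_mult mat3_simps
  have "d = 0" using 0[of "vector [1,0,0]" "vector [0,0,1]"] by (simp add: A D)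
  moreover have "g = 0" using 0[of "vector [1,0,0]" "vector [0,1,0]"] by (simp add: A D)
  moreover have "b = 0" using 0[of "vector [0,1,0]" "vector [0,0,1]"] by (simp add: A D)
  moreover have "h = 0" using 0[of "vector [0,1,0]" "vector [1,0,0]"] by (simp add: A D)
  moreover have "c = 0" using 0[of "vector [0,0,1]" "vector [0,1,0]"] by (simp add: A D)
  moreover have "f = 0" using 0[of "vector [0,0,1]" "vector [1,0,0]"] by (simp add: A D)
  moreover have "a = e" using 0[of "vector [1,1,0]" "vector [0,0,1]"] calculation
    by (simp add: A D)
  moreover have "a = i" using 0[of "vector [1,0,1]" "vector [0,1,0]"] calculation
    by (simp add: A D)
  ultimately show False
    using assms[of a] by (simp add: A mat_eq_mat3)
qed

lemma nonscalar_similar: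
  fixes A :: "'a::field ^ 3 ^ 3"
  assumes "\<And>k. A \<noteq> mat k"
  obtains p w1 q w2 k l where "similar_mat A (mat3 0 p w1 1 q w2 0 k l)"
proof -
  obtain v w where "det (columns3 v (A *v v) w) \<noteq> 0"
    using nonscalar_noneigenvector[OF assms] .
  moreover define P where "P = columns3 v (A *v v) w"
  ultimately obtain Q where Q: "P ** Q = mat 1" "Q ** P = mat 1"
    by (metis invertible_def invertible_det_nz)
  define B where "B = Q ** A ** P"
  have PB: "P ** B = A ** P"
    by (simp add: B_def matrix_mul_assoc Q)
  then have "A = P ** B ** Q"
    by (metis Q(1) matrix_mul_assoc matrix_mul_rid)
  with Q have sim: "similar_mat A B"
    unfolding similar_mat_def by blast
  have e: "P *v vector [1, 0, 0] = v" "P *v vector [0, 1, 0] = A *v v"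
    by (simp_all add: P_def columns3_def mat3_vector_mult vec_eq_iff forall_3)
  have "B *v vector [1, 0, 0] = Q *v (A *v v)"
    unfolding B_def e(1)[symmetric] by (simp add: matrix_vector_mul_assoc matrix_mul_assoc)
  also have "\<dots> = vector [0, 1, 0]"
    unfolding e(2)[symmetric] by (simp add: matrix_vector_mul_assoc Q)
  finally have "B *v vector [1, 0, 0] = vector [0, 1, 0]" .
  moreover obtain a b c d e f g h i where B: "B = mat3 a b c d e f g h i"
    using mat3_exhaust by blast
  ultimately have "a = 0" "d = 1" "g = 0"
    by (simp_all add: mat3_vector_mult vec_eq_iff forall_3)
  with sim B that show thesis
    by simp
qed

lemma nonscalar_normal_form:
  fixes A :: "'a::field ^ 3 ^ 3"
  assumes "det A = 1" and "\<And>k. A \<noteq> mat k"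
  obtains "similar_mat A (companion (trace A) (sum_minors A))"
  | l where "l \<noteq> 0" "similar_mat A (reflection_form l)"
proof -
  obtain p w1 q w2 k l where sim: "similar_mat A (mat3 0 p w1 1 q w2 0 k l)"
    using nonscalar_similar[OF assms(2)] .
  define B where "B = mat3 0 p w1 1 q w2 0 k l"
  have B1: "det B = 1"
    using assms(1) similar_mat_det[OF sim] by (simp add: B_def)
  have inv: "trace A = trace B" "sum_minors A = sum_minors B"
    using similar_mat_trace[OF sim] similar_mat_sum_minors[OF sim] by (simp_all add: B_def)
  show thesis
    \<comment> \<open>If the vectors \<open>e1\<close>, \<open>e3 - w2 e1\<close> and \<open>e3 + (1 - w2) e1\<close> are not cyclic for \<open>B\<close>, then \<open>B - l\<close> has
      rank one.\<close>
  proof (cases "\<exists>v. det (columns3 v (B *v v) (B *v (B *v v))) \<noteq> 0")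
    case True
    then have "similar_mat B (companion (trace B) (sum_minors B))"
      using similar_companion[OF B1] by blast
    then show thesis
      using that(1) sim similar_mat_trans unfolding inv B_def by blast
  next
    case False
    then have 0: "det (columns3 v (B *v v) (B *v (B *v v))) = 0" for v
      by blast
    note D = B_def columns3_def mat3_vector_mult mat3_simps
    have k: "k = 0"
      using 0[of "vector [1, 0, 0]"] by (simp add: D)
    have t: "w1 = - l * w2"
    proof -
      have "(w1 + l * w2) * (w1 + l * w2) = 0"
        using 0[of "vector [- w2, 0, 1]"] by (simp add: D k algebra_simps)
      then have "w1 + l * w2 = 0"
        by simp
      then show ?thesis
        by (simp add: eq_neg_iff_add_eq_0)
    qed
    have p: "p = l * l - l * q"
      using 0[of "vector [1 - w2, 0, 1]"] by (simp add: D k t algebra_simps)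
    have pl: "p * l = - 1"
      using B1 by (simp add: D k) (metis minus_minus)
    then have l: "l \<noteq> 0"
      by auto
    have p': "p = - 1 / l"
      using pl l by (simp add: field_simps)
    have q: "q = l + 1 / l\<^sup>2"
      using p l unfolding p' by (simp add: field_simps power2_eq_square)
    \<comment> \<open>Since \<open>k = 0\<close>, the span of \<open>e1\<close> and
      \<open>e2\<close> is invariant; \<open>e3 - w2 e1\<close> is an eigenvector for
      \<open>l\<close> complementing it.\<close>
    have "similar_mat B (reflection_form l)"
      by (rule similar_matI[of "mat3 1 0 (- w2) 0 1 0 0 0 1"])
        (simp_all add: D reflection_form_def k t p' q algebra_simps)
    then show thesis
      using that(2) l sim similar_mat_trans unfolding B_def by blast
  qed
qed

lemma near_scalar_similar_reflection_form:
  fixes A :: "'a::field ^ 3 ^ 3"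
  assumes "det A = 1" and "\<And>k. A \<noteq> mat k" and "near_scalar A l"
  shows "similar_mat A (reflection_form l)"
  using assms(1,2)
proof (cases rule: nonscalar_normal_form)
  case 1
  then show ?thesis
    using similar_near_scalar[OF similar_mat_sym assms(3)] not_near_scalar_companion by blast
next
  case (2 m)
  then have "near_scalar (reflection_form m) l"
    using similar_near_scalar[OF similar_mat_sym assms(3)] by blast
  with 2 show ?thesis
    by (simp add: near_scalar_reflection_form)
qed

text \<open>A test for cyclicity by minors of \<open>A - mat l\<close>. Only
  \<open>l \<noteq> 0\<close> matters, because determinant one excludes \<open>l = 0\<close> both
  for scalar matrices and for reflection forms.\<close>

lemma not_near_scalar_similar_companion:
  fixes A :: "'a::field ^ 3 ^ 3"
  assumes "det A = 1" and "\<And>l. l \<noteq> 0 \<Longrightarrow> \<not> near_scalar A l"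
  shows "similar_mat A (companion (trace A) (sum_minors A))"
proof -
  have "A \<noteq> mat k" for k
  proof
    assume k: "A = mat k"
    then have "near_scalar A k"
      by (intro near_scalarI[of _ _ 0 0 0 0 0 0]) (simp only: mat3_simps, simp)
    moreover have "k \<noteq> 0"
      using assms(1) k by (auto simp: mat3_simps)
    ultimately show False
      using assms(2) by blast
  qed
  with assms(1) show ?thesis
  proof (cases rule: nonscalar_normal_form)
    case (2 m)
    then have "near_scalar A m"
      using similar_near_scalar near_scalar_reflection_form[of m m] by blast
    then show ?thesis
      using assms(2) 2(1) by blast
  qed
qed

subsection \<open>The parameter equations\<close>

text \<open>Clearing denominators by \<open>c\<close>, these say that the product of the two matrices \<open>B\<close>, \<open>C\<close> in
  \<open>companion_factorisation_neq\<close> has trace \<open>s\<close> and second coefficient \<open>r\<close>. The second equation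
  confines \<open>(u, w)\<close> to a line, on which the first one becomes a quadratic equation in \<open>w\<close>. Its
  leading coefficient is a multiple of \<open>y c + c + y\<close>.\<close>

definition parameter_eqs :: "'a::field \<Rightarrow> 'a \<Rightarrow> 'a \<Rightarrow> 'a \<Rightarrow> 'a \<Rightarrow> 'a \<Rightarrow> 'a \<Rightarrow> 'a \<Rightarrow> 'a \<Rightarrow> 'a \<Rightarrow> bool" where
  "parameter_eqs a b a' b' s r c y u w \<longleftrightarrow>
     c * s = c * y * ((a - w) * w - b) + c * w * u + y * (u * (a' - u) - b') \<and>
     c * r = - u - c * (a' - u) * y - y * (a - w) - c * c * w"

text \<open>With \<open>c = 1\<close> and \<open>y = - 1/2\<close> we have \<open>y c + c + y = 0\<close>, and the equation for \<open>w\<close> is linear.\<close>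

lemma parameters_char_large:
  fixes a b s r :: "'a::field"
  assumes "a \<noteq> b" and 2: "(2::'a) \<noteq> 0" and 3: "(3::'a) \<noteq> 0"
  shows "\<exists>c y u w. c \<noteq> 0 \<and> y \<noteq> 0 \<and> parameter_eqs a b b a s r c y u w"
proof -
  \<comment> \<open>\<open>K\<close> is the value of \<open>u + w\<close> forced by the second
    equation; substituting \<open>u = K - w\<close> in the first one leaves the linear equation for
    \<open>w\<close>.\<close>
  obtain K where K: "3 * K = a + b - 2 * r"
    using 3 that[of "(a + b - 2 * r) / 3"] by simp
  obtain w where w: "(b - a) * w = 2 * s - a - b + K * (b - K)"
    using \<open>a \<noteq> b\<close> that[of "(2 * s - a - b + K * (b - K)) / (b - a)"] by simp
  obtain y :: 'a where y: "2 * y = - 1"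
    using 2 that[of "- 1 / 2"] by simp
  have "2 * r - 2 * (- (K - w) - (b - (K - w)) * y - y * (a - w) - w) =
      (2 * y - - 1) * (a + b - K) + (3 * K - (a + b - 2 * r))"
    by (simp add: algebra_simps)
  then have "2 * r = 2 * (- (K - w) - (b - (K - w)) * y - y * (a - w) - w)"
    by (simp add: K y)
  then have "r = - (K - w) - (b - (K - w)) * y - y * (a - w) - w"
    unfolding mult_left_cancel[OF 2] .
  moreover have "2 * s - 2 * (y * ((a - w) * w - b) + w * (K - w) + y * ((K - w) * (b - (K - w)) - a)) =
      - (2 * y - - 1) * ((a - w) * w - b + (K - w) * (b - K + w) - a)
        - ((b - a) * w - (2 * s - a - b + K * (b - K)))"
    by (simp add: algebra_simps)
  then have "2 * s = 2 * (y * ((a - w) * w - b) + w * (K - w) + y * ((K - w) * (b - (K - w)) - a))"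
    by (simp add: w y)
  then have "s = y * ((a - w) * w - b) + w * (K - w) + y * ((K - w) * (b - (K - w)) - a)"
    unfolding mult_left_cancel[OF 2] .
  ultimately have "parameter_eqs a b b a s r 1 y (K - w) w"
    by (simp add: parameter_eqs_def)
  moreover have "y \<noteq> 0"
    using y by auto
  ultimately show ?thesis
    by (metis one_neq_zero)
qed

text \<open>Squaring is additive in characteristic two, hence injective, and on a finite field
  surjective.\<close>

lemma sqrt_char_2:
  fixes x :: "'a::{field, finite}"
  assumes "(2::'a) = 0"
  obtains t where "t * t = x"
proof -
  have "inj (\<lambda>t::'a. t * t)"
  proof (rule injI)
    fix t u :: 'a
    assume "t * t = u * u"
    moreover have "(t - u) * (t - u) = (t * t - u * u) + 2 * (u * u - t * u)"
      by (simp add: algebra_simps)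
    ultimately have "(t - u) * (t - u) = 0"
      by (simp add: assms)
    then show "t = u"
      by simp
  qed
  then have "surj (\<lambda>t::'a. t * t)"
    by (simp add: finite_UNIV_inj_surj)
  then show ?thesis
    by (metis surjD that)
qed

text \<open>Here \<open>y\<close> is chosen such that the linear term of the equation for \<open>w\<close> vanishes instead.\<close>

lemma parameters_char_2:
  fixes a b s r :: "'a::{field, finite}"
  assumes "a \<noteq> b" and 2: "(2::'a) = 0"
  shows "\<exists>a' b' c y u w. (a', b') \<in> {(a, b), (b, a)} \<and> c \<noteq> 0 \<and> y \<noteq> 0 \<and>
    parameter_eqs a b a' b' s r c y u w"
proof (cases "r = 0")
  case True
  \<comment> \<open>The choice made for \<open>r \<noteq> 0\<close> would give \<open>y = 0\<close>
    here. With equal data for both factors, \<open>c = y = 1\<close> and \<open>u = w = t\<close>,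
    the second equation is trivial and the first one says \<open>t * t = s\<close>.\<close>
  obtain t where t: "t * t = s"
    using sqrt_char_2[OF 2] .
  have "(a - t) * t - b + t * t + (t * (a - t) - b) - s = 2 * (a * t - t * t - b) + (t * t - s)"
    by (simp add: algebra_simps)
  then have "(a - t) * t - b + t * t + (t * (a - t) - b) = s"
    by (simp add: 2 t)
  moreover have "- t - (a - t) - (a - t) - t = - 2 * a"
    by (simp add: algebra_simps)
  then have "- t - (a - t) - (a - t) - t = 0"
    by (simp add: 2)
  ultimately have "parameter_eqs a b a b s r 1 1 t t"
    by (simp add: parameter_eqs_def True)
  then show ?thesis
    by (metis insertI1 one_neq_zero)
next
  case False
  obtain y where "y * y = r / (a - b)"
    using sqrt_char_2[OF 2] .
  then have y: "y * y * (a - b) = r"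
    using \<open>a \<noteq> b\<close> by simp
  \<comment> \<open>With \<open>u = w + K\<close> the second equation becomes
    \<open>y * K = r\<close>, and the first one prescribes the square of \<open>w\<close>.\<close>
  define K where "K = y * (a - b)"
  obtain w where w: "w * w = s + y * (a + b) + y * K * b + y * K * K"
    using sqrt_char_2[OF 2] .
  have "r - (- (w + K) - (b - (w + K)) * y - y * (a - w) - w) =
      2 * (w - y * w + y * a) + (r - y * y * (a - b))"
    by (simp add: K_def algebra_simps)
  then have "r = - (w + K) - (b - (w + K)) * y - y * (a - w) - w"
    by (simp add: 2 y)
  moreover have "y * ((a - w) * w - b) + w * (w + K) + y * ((w + K) * (b - (w + K)) - a) - s =
      (w * w - (s + y * (a + b) + y * K * b + y * K * K))
        + 2 * (y * (a * w - w * w - K * w + K * b))"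
    by (simp add: K_def algebra_simps)
  then have "y * ((a - w) * w - b) + w * (w + K) + y * ((w + K) * (b - (w + K)) - a) = s"
    by (simp add: 2 w)
  ultimately have "parameter_eqs a b b a s r 1 y (w + K) w"
    by (simp add: parameter_eqs_def)
  moreover have "y \<noteq> 0"
    using y False by auto
  ultimately show ?thesis
    by (metis insertI1 insertI2 one_neq_zero)
qed

text \<open>Again \<open>y c + c + y = 0\<close>. The coefficient of \<open>w\<close> is nonzero unless \<open>(a - r) c = r - b\<close>.\<close>

lemma parameters_char_3:
  fixes a b s r :: "'a::field"
  assumes "a \<noteq> b" and 3: "(3::'a) = 0" and t: "t \<notin> {0, 1, - 1::'a}"
  shows "\<exists>c y u w. c \<noteq> 0 \<and> y \<noteq> 0 \<and> parameter_eqs a b b a s r c y u w"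
proof -
  \<comment> \<open>One of \<open>t\<close> and \<open>t + 1\<close> works: if both satisfied the
    excluded equation, subtracting would give \<open>a = r\<close> and then
    \<open>r = b\<close>.\<close>
  have "\<exists>c. c \<notin> {0, 1, - 1} \<and> (a - r) * c \<noteq> r - b"
  proof (cases "(a - r) * t = r - b")
    case True
    have "(a - r) * (t + 1) \<noteq> r - b"
    proof
      assume "(a - r) * (t + 1) = r - b"
      with True have "a = r"
        by (simp add: algebra_simps)
      with True \<open>a \<noteq> b\<close> show False
        by simp
    qed
    moreover have "t + 1 \<noteq> 0" "t + 1 \<noteq> 1" "t + 1 \<noteq> - 1"
    proof -
      show "t + 1 \<noteq> 0"
        using t by (simp add: eq_neg_iff_add_eq_0)
      show "t + 1 \<noteq> 1"
        using t by simp
      show "t + 1 \<noteq> - 1"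
      proof
        assume "t + 1 = - 1"
        moreover have "t - 1 = (t + 1 - - 1) - 3"
          by (simp add: algebra_simps)
        ultimately have "t = 1"
          by (simp add: 3)
        then show False
          using t by simp
      qed
    qed
    ultimately show ?thesis
      by blast
  qed (use t in blast)
  then obtain c where c: "c \<noteq> 0" "c \<noteq> 1" "c \<noteq> - 1" and ne: "(a - r) * c \<noteq> r - b"
    by blast
  have c1: "1 + c \<noteq> 0" "(c - 1) * (c - 1) \<noteq> 0"
    using c by (auto simp: eq_neg_iff_add_eq_0 add.commute)
  \<comment> \<open>\<open>K\<close> is the value of \<open>u + c * w\<close> forced by the second
    equation with \<open>y = - c / (1 + c)\<close>, using \<open>1 + c + c^2 = (c - 1)^2\<close> in
    characteristic three. \<open>W\<close> is the coefficient of \<open>w\<close> in the first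
    equation.\<close>
  obtain K where K: "(c - 1) * (c - 1) * K = - c * ((1 + c) * r - b * c - a)"
    using c1 that[of "- c * ((1 + c) * r - b * c - a) / ((c - 1) * (c - 1))"] by simp
  define W where "W = K * (1 - c) - c * (a - b)"
  have "(c - 1) * W = - ((c - 1) * (c - 1) * K - - c * ((1 + c) * r - b * c - a))
      - c * ((a - r) * c - (r - b))"
    unfolding W_def by (simp add: algebra_simps)
  then have W: "W \<noteq> 0"
    using c ne by (auto simp: K)
  obtain w where w: "w * W = (1 + c) * s - c * b + K * (b - K) - a"
    using W that[of "((1 + c) * s - c * b + K * (b - K) - a) / W"] by simp
  define u where "u = K - c * w"
  obtain y where y: "(1 + c) * y = - c"
    using c1 that[of "- c / (1 + c)"] by simp
  have "(1 + c) * (c * r) - (1 + c) * (- u - c * (b - u) * y - y * (a - w) - c * c * w) =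
      ((c - 1) * (c - 1) * K - - c * ((1 + c) * r - b * c - a)) + 3 * (c * K)
        + ((1 + c) * y - - c) * (c * (b - u) + (a - w))"
    unfolding u_def by (simp add: algebra_simps)
  then have "(1 + c) * (c * r) = (1 + c) * (- u - c * (b - u) * y - y * (a - w) - c * c * w)"
    unfolding K y 3 by simp
  then have "c * r = - u - c * (b - u) * y - y * (a - w) - c * c * w"
    unfolding mult_left_cancel[OF c1(1)] .
  moreover have "(1 + c) * (c * s) -
      (1 + c) * (c * y * ((a - w) * w - b) + c * w * u + y * (u * (b - u) - a)) =
      - c * (w * W - ((1 + c) * s - c * b + K * (b - K) - a))
        - ((1 + c) * y - - c) * (c * ((a - w) * w - b) + (u * (b - u) - a))"
    unfolding u_def W_def by (simp add: algebra_simps)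
  then have "(1 + c) * (c * s) =
      (1 + c) * (c * y * ((a - w) * w - b) + c * w * u + y * (u * (b - u) - a))"
    unfolding w y by simp
  then have "c * s = c * y * ((a - w) * w - b) + c * w * u + y * (u * (b - u) - a)"
    unfolding mult_left_cancel[OF c1(1)] .
  ultimately have "parameter_eqs a b b a s r c y u w"
    by (simp add: parameter_eqs_def)
  moreover have "y \<noteq> 0"
    using y c by auto
  ultimately show ?thesis
    using c by blast
qed

text \<open>No \<open>c\<close> outside \<open>{0, 1, - 1}\<close> exists here. But everything
  except \<open>- 1\<close> is a square, so three choices of \<open>(c, y)\<close> suffice unless
  their critical quantities all equal \<open>- 1\<close>, which a check of all values rules
  out.\<close>

lemma parameters_three_elements:
  fixes a b s r :: "'a::field"
  assumes "a \<noteq> b" and 3: "(3::'a) = 0" and univ: "\<And>t. t \<in> {0, 1, - 1::'a}"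
  shows "\<exists>a' b' c y u w. (a', b') \<in> {(a, b), (b, a)} \<and> c \<noteq> 0 \<and> y \<noteq> 0 \<and>
    parameter_eqs a b a' b' s r c y u w"
proof -
  have sq: "\<exists>t. t * t = x" if "x \<noteq> - 1" for x :: 'a
    using univ[of x] that by (metis insert_iff empty_iff mult_1 mult_zero_left)
  \<comment> \<open>For \<open>(c, y) = (1, -1), (-1, 1), (-1, -1)\<close> the equations are solvable iff \<open>x1\<close>, \<open>x2\<close>, \<open>x3\<close>,
    respectively, is a square.\<close>
  define u2 where "u2 = a - b - r"
  define w3 where "w3 = b - a - r"
  define x1 where "x1 = s + a * (r + a) + b"
  define x2 where "x2 = (a + u2) * (a + u2) + u2 * u2 - u2 * b + a - b - s"
  define x3 where "x3 = (w3 + b) * (w3 + b) + w3 * w3 - a * w3 + b - a - s"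
  have two: "(2::'a) = - 1"
    using 3 by (simp add: eq_neg_iff_add_eq_0)
  have ne: "(1::'a) \<noteq> - 1"
  proof
    assume "(1::'a) = - 1"
    moreover have "(3::'a) = 2 + 1"
      by simp
    ultimately show False
      using 3 two by simp
  qed
  have num: "numeral (Num.Bit0 k) = - (numeral k :: 'a)" "numeral (Num.Bit1 k) = 1 - (numeral k :: 'a)"
    for k
  proof -
    have "numeral k + numeral k = 2 * (numeral k :: 'a)"
      by (rule mult_2[symmetric])
    then have double: "numeral k + numeral k = - (numeral k :: 'a)"
      by (simp only: two mult_minus1)
    show "numeral (Num.Bit0 k) = - (numeral k :: 'a)"
      by (simp only: numeral_Bit0 double)
    show "numeral (Num.Bit1 k) = 1 - (numeral k :: 'a)"
      by (simp only: numeral_Bit1 double) simp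
  qed
  have "x1 \<noteq> - 1 \<or> x2 \<noteq> - 1 \<or> x3 \<noteq> - 1"
    using univ[of a] univ[of b] univ[of s] univ[of r] \<open>a \<noteq> b\<close> unfolding x1_def x2_def x3_def u2_def w3_def
    by (elim insertE emptyE) (simp_all add: num ne ne[symmetric])
  then consider t where "t * t = x1" | t where "t * t = x2" | t where "t * t = x3"
    using sq by blast
  then show ?thesis
  proof cases
    case (1 t)
    define u where "u = - (r + a - t)"
    define w where "w = - (r + a + t)"
    have "r - (- u + (a - u) + (a - w) - w) = - 3 * (r + 2 * a)"
      unfolding u_def w_def by (simp add: algebra_simps)
    moreover have "- ((a - w) * w - b) + w * u - (u * (a - u) - b) - s =
        3 * ((r + a) * (r + a) + a * (r + a) + b) + (t * t - x1)"
      unfolding u_def w_def x1_def by (simp add: algebra_simps)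
    ultimately have "parameter_eqs a b a b s r 1 (- 1) u w"
      using 1 by (simp add: parameter_eqs_def 3)
    then show ?thesis
      by (metis insertI1 one_neq_zero neg_equal_0_iff_equal)
  next
    case (2 t)
    define w where "w = t - (a + u2)"
    have "- r - (- u2 + (b - u2) - (a - w) - w) = - 3 * (b - a + r)"
      unfolding u2_def by (simp add: algebra_simps)
    moreover have "- s - (- ((a - w) * w - b) - w * u2 + (u2 * (b - u2) - a)) =
        - (t * t - x2) - 3 * ((a + u2) * (a + u2) - t * (a + u2))"
      unfolding w_def x2_def by (simp add: algebra_simps)
    ultimately have "parameter_eqs a b b a s r (- 1) 1 u2 w"
      using 2 by (simp add: parameter_eqs_def 3)
    then show ?thesis
      by (metis insertI1 insertI2 one_neq_zero neg_equal_0_iff_equal)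
  next
    case (3 t)
    define u where "u = t - (w3 + b)"
    have "- r - (- u - (b - u) + (a - w3) - w3) = - 3 * (r + a - b)"
      unfolding w3_def by (simp add: algebra_simps)
    moreover have "- s - ((a - w3) * w3 - b - w3 * u - (u * (b - u) - a)) =
        - (t * t - x3) - 3 * ((w3 + b) * (w3 + b) - t * (w3 + b))"
      unfolding u_def x3_def by (simp add: algebra_simps)
    ultimately have "parameter_eqs a b b a s r (- 1) (- 1) u w3"
      using 3 by (simp add: parameter_eqs_def assms(2))
    then show ?thesis
      by (metis insertI1 insertI2 one_neq_zero neg_equal_0_iff_equal)
  qed
qed

lemma parameters_exist:
  fixes a b s r :: "'a::{field, finite}"
  assumes "a \<noteq> b"
  obtains a' b' c y u w where "(a', b') \<in> {(a, b), (b, a)}" "c \<noteq> 0" "y \<noteq> 0"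
    "parameter_eqs a b a' b' s r c y u w"
proof -
  consider "(2::'a) = 0" | "(2::'a) \<noteq> 0" "(3::'a) \<noteq> 0"
    | t where "(3::'a) = 0" "t \<notin> {0, 1, - 1::'a}" | "(3::'a) = 0" "\<And>t. t \<in> {0, 1, - 1::'a}"
    by blast
  then show thesis
  proof cases
    case 1
    then show thesis
      using parameters_char_2[OF assms 1] that by blast
  next
    case 2
    then show thesis
      using parameters_char_large[OF assms 2] that by blast
  next
    case (3 t)
    then show thesis
      using parameters_char_3[OF assms 3] that by blast
  next
    case 4
    then show thesis
      using parameters_three_elements[OF assms 4] that by blast
  qed
qed

subsection \<open>Factorisation with prescribed characteristic polynomials\<close>

definition char_data :: "'a::field \<Rightarrow> 'a \<Rightarrow> 'a ^ 3 ^ 3 \<Rightarrow> bool" where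
  "char_data a b B \<longleftrightarrow> det B = 1 \<and> trace B = a \<and> sum_minors B = b"

lemma char_data_similar: "similar_mat A B \<Longrightarrow> char_data a b B \<Longrightarrow> char_data a b A"
  by (simp add: char_data_def similar_mat_det similar_mat_trace similar_mat_sum_minors)

lemma char_data_companion: "char_data a b (companion a b)"
  by (simp add: char_data_def companion_def mat3_simps)

text \<open>For \<open>a = b\<close> the prescribed polynomial has the root \<open>1\<close>. The matrix \<open>A\<close> in the proof has first row
  \<open>(0, 0, 1)\<close>, like \<open>companion a a\<close>, and therefore the first row of \<open>B\<close> is \<open>(1, 0, 0)\<close>.\<close>

lemma companion_factorisation_eq:
  fixes a s r :: "'a::field"
  obtains B where "char_data a a B" "similar_mat (companion s r) (B ** companion a a)"
proof
  define B where "B = mat3 1 0 0 (a * a - 4 * a + s - r + 2) (a - 2) 1 (a * a - 4 * a + s - 1) (a - 3) 1"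
  define A where "A = mat3 0 0 1 (a - 2) 1 (s - r - a + 2) (a - 3) 1 (s - 1)"
  show B: "char_data a a B"
    by (simp add: char_data_def B_def mat3_simps)
  have A: "B ** companion a a = A"
    by (simp add: A_def B_def companion_def mat3_simps algebra_simps)
  have "similar_mat A (companion (trace A) (sum_minors A))"
  proof (rule not_near_scalar_similar_companion)
    show "det A = 1"
      by (simp add: A_def mat3_simps algebra_simps)
    show "\<not> near_scalar A l" if "l \<noteq> 0" for l
      using that unfolding A_def by (auto dest: near_scalar_minors(2))
  qed
  moreover have "trace A = s" "sum_minors A = r"
    by (simp_all add: A_def mat3_simps algebra_simps)
  ultimately show "similar_mat (companion s r) (B ** companion a a)"
    unfolding A by (simp add: similar_mat_sym)
qed

text \<open>The entries \<open>d\<close>, \<open>e\<close> normalise the determinants of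
  \<open>C\<close> and \<open>B\<close>, and \<open>F\<close>, \<open>H\<close> adjust their second
  coefficients. The remaining freedom \<open>c\<close>, \<open>y\<close>, \<open>u\<close>,
  \<open>w\<close> is spent on the trace and second coefficient of the product.\<close>

lemma companion_factorisation_neq:
  fixes a b s r :: "'a::{field, finite}"
  assumes "a \<noteq> b"
  obtains B C a' b' where "char_data a b B" "(a', b') \<in> {(a, b), (b, a)}" "char_data a' b' C"
    "similar_mat (companion s r) (B ** C)"
proof -
  obtain a' b' c y u w where ab: "(a', b') \<in> {(a, b), (b, a)}" and c: "c \<noteq> 0" and y: "y \<noteq> 0"
    and eqs: "parameter_eqs a b a' b' s r c y u w"
    using parameters_exist[OF assms] .
  define d where "d = 1 / c"
  define e where "e = 1 / y"
  have cd: "c * d = 1" and ye: "y * e = 1"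
    using c y by (simp_all add: d_def e_def)
  define F where "F = (u * (a' - u) - b') * d"
  define H where "H = ((a - w) * w - b) * y"
  have cF: "F * c = u * (a' - u) - b'" and He: "H * e = (a - w) * w - b"
    using c y by (simp_all add: F_def H_def d_def e_def)
  define B where "B = mat3 (a - w) H 1 e w 0 0 y 0"
  define C where "C = mat3 0 0 d 1 u F 0 c (a' - u)"
  define A where "A = mat3 H (H * u + c) ((a - w) * d + H * F + (a' - u))
    w (w * u) (e * d + w * F) y (y * u) (y * F)"
  have A: "B ** C = A"
    by (simp add: A_def B_def C_def mat3_simps algebra_simps)
  have B: "char_data a b B"
    using ye He by (simp add: char_data_def B_def mat3_simps algebra_simps)
  have C: "char_data a' b' C"
    using cd cF by (simp add: char_data_def C_def mat3_simps algebra_simps)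
  have trA: "trace A = s"
  proof -
    have "c * trace A = c * y * ((a - w) * w - b) + c * w * u + y * (F * c)"
      by (simp add: A_def H_def mat3_simps algebra_simps)
    also have "\<dots> = c * s"
      unfolding cF using eqs by (simp add: parameter_eqs_def)
    finally show ?thesis
      using c by simp
  qed
  have smA: "sum_minors A = r"
  proof -
    have sm: "sum_minors A = - c * w - y * (a - w) * d - y * (a' - u) - u * d * (y * e)"
      by (simp add: A_def mat3_simps algebra_simps)
    have "c * sum_minors A = - c * c * w - y * (a - w) * (c * d) - c * y * (a' - u) - u * (c * d)"
      unfolding sm ye by (simp add: algebra_simps)
    also have "\<dots> = c * r"
      unfolding cd using eqs by (simp add: parameter_eqs_def algebra_simps)
    finally show ?thesis
      using c by simp
  qed
  have "similar_mat A (companion (trace A) (sum_minors A))"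
  proof (rule not_near_scalar_similar_companion)
    show "det A = 1"
      using B C unfolding A[symmetric] by (simp add: char_data_def det_mul)
    show "\<not> near_scalar A l" if "l \<noteq> 0" for l
    proof
      assume "near_scalar A l"
      \<comment> \<open>The minor of \<open>A - mat l\<close> in rows 2, 3 and columns 1, 2 is
        \<open>l * y\<close>.\<close>
      then have "w * (y * u) = (w * u - l) * y"
        unfolding A_def by (rule near_scalar_minors(3))
      then have "l * y = 0"
        by (simp add: algebra_simps)
      then show False
        using that y by simp
    qed
  qed
  then have "similar_mat (companion s r) (B ** C)"
    unfolding A trA smA by (rule similar_mat_sym)
  with ab B C that show thesis
    by blast
qed

text \<open>Subtracting \<open>m\<close> leaves only the first row. The second hypothesis excludes
  exactly the scalar case.\<close>

lemma reflection_form_similar: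
  assumes "m \<noteq> 0" "w1 \<noteq> 0 \<or> w2 \<noteq> 0 \<or> m ^ 3 \<noteq> 1"
  shows "similar_mat (reflection_form m) (mat3 (1 / m\<^sup>2) w1 w2 0 m 0 0 0 m)"
proof (rule similar_mat_sym, rule near_scalar_similar_reflection_form)
  show "det (mat3 (1 / m\<^sup>2) w1 w2 0 m 0 0 0 m) = 1"
    using assms(1) by (simp add: mat3_simps power2_eq_square)
  show "mat3 (1 / m\<^sup>2) w1 w2 0 m 0 0 0 m \<noteq> mat k" for k
    using assms by (auto simp: mat3_simps field_simps power3_eq_cube power2_eq_square)
  show "near_scalar (mat3 (1 / m\<^sup>2) w1 w2 0 m 0 0 0 m) m"
    by (rule near_scalarI[of _ _ 1 "1 / m\<^sup>2 - m" w1 w2 0 0]) (simp add: mat3_simps)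
qed

lemma reflection_form_factorisation:
  fixes a b m :: "'a::field"
  assumes m: "m \<noteq> 0" "m ^ 3 \<noteq> 1 \<or> m = 1"
  obtains B C where "char_data a b B" "char_data a b C" "similar_mat (reflection_form m) (B ** C)"
proof (cases "m = 1 \<and> a = b")
  case True
  \<comment> \<open>The general construction would give \<open>w1 = w2 = 0\<close> and the product
    \<open>mat 1\<close>. Instead, the upper left blocks of \<open>B\<close> and \<open>C\<close>
    are mutually inverse, and the corner entry of \<open>B\<close> makes the product a
    transvection.\<close>
  define B where "B = mat3 (a - 1) (- 1) 1 1 0 0 0 0 1"
  define C where "C = mat3 0 1 0 (- 1) (a - 1) 0 0 0 1"
  have "B ** C = mat3 (1 / m\<^sup>2) 0 1 0 m 0 0 0 m"
    using True by (simp add: B_def C_def mat3_simps)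
  then have "similar_mat (reflection_form m) (B ** C)"
    using reflection_form_similar[of m 0 1] m by simp
  moreover have "char_data a b B" "char_data a b C"
    using True by (simp_all add: char_data_def B_def C_def mat3_simps)
  ultimately show thesis
    using that by blast
next
  case False
  \<comment> \<open>\<open>C\<close> is the inverse of \<open>companion b a\<close>, and \<open>B\<close> differs from \<open>m * companion b a\<close> only in its
    first row, which is chosen such that \<open>char_data a b B\<close>.\<close>
  define w1 where "w1 = a - m * b"
  define w2 where "w2 = (w1 * m * b + m * m * a - b) / m"
  define w3 where "w3 = 1 / m\<^sup>2 - m - w1 * a + w2 * b"
  have w2: "w2 * m = w1 * m * b + m * m * a - b"
    using m by (simp add: w2_def)
  define B where "B = mat3 w1 w2 (m + w3) m 0 (- m * a) 0 m (m * b)"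
  define C where "C = mat3 a 1 0 (- b) 0 1 1 0 0"
  have BC: "B ** C = mat3 (1 / m\<^sup>2) w1 w2 0 m 0 0 0 m"
    by (simp add: B_def C_def mat3_simps w3_def algebra_simps)
  have C: "char_data a b C"
    by (simp add: char_data_def C_def mat3_simps)
  have "det (B ** C) = 1"
    unfolding BC using m by (simp add: mat3_simps power2_eq_square)
  then have "det B = 1"
    using C by (simp add: det_mul char_data_def)
  then have B: "char_data a b B"
    using w2 by (simp add: char_data_def B_def mat3_simps w1_def algebra_simps)
  have "w1 \<noteq> 0 \<or> w2 \<noteq> 0 \<or> m ^ 3 \<noteq> 1"
  proof (cases "m = 1")
    case True
    then show ?thesis
      using False by (simp add: w1_def)
  qed (use m in blast)
  then have "similar_mat (reflection_form m) (B ** C)"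
    unfolding BC by (rule reflection_form_similar[OF m(1)])
  with B C that show thesis
    by blast
qed

text \<open>For a cube root of unity \<open>l\<close>, the central factor \<open>1 / l\<close>
  preserves determinant one and turns \<open>A - mat l\<close> into the difference from
  \<open>mat 1\<close>. This removes the case left out in
  \<open>reflection_form_factorisation\<close>.\<close>

lemma mat_mult_reflection_form:
  fixes A :: "'a::field ^ 3 ^ 3"
  assumes "l \<noteq> 0" "l ^ 3 = 1" and A: "similar_mat A (reflection_form l)"
  shows "similar_mat (mat (1 / l) ** A) (reflection_form 1)"
proof -
  have "near_scalar A l"
    using similar_near_scalar[OF A] near_scalar_reflection_form assms(1) by blast
  then obtain U V where UV: "A - mat l = U ** mat3 1 0 0 0 0 0 0 0 0 ** V"
    unfolding near_scalar_def by blast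
  have detA: "det A = 1"
    using assms by (simp add: similar_mat_det reflection_form_def mat3_simps)
  show ?thesis
  proof (rule near_scalar_similar_reflection_form)
    show "det (mat (1 / l) ** A) = 1"
      using assms(1,2) detA by (simp add: det_mul mat3_simps power3_eq_cube)
    show "mat (1 / l) ** A \<noteq> mat k" for k
    proof
      assume "mat (1 / l) ** A = mat k"
      then have "mat l ** (mat (1 / l) ** A) = mat l ** mat k"
        by simp
      then have "A = mat (l * k)"
        using assms(1) by (simp add: matrix_mul_assoc mat_mult_mat)
      then have "similar_mat (reflection_form l) (mat (l * k))"
        using A similar_mat_sym by blast
      then have "reflection_form l = mat (l * k)"
        by (rule similar_mat_mat)
      then show False
        by (simp add: reflection_form_def mat3_simps)
    qed
    have "mat (1 / l) ** A - mat 1 = mat (1 / l) ** (A - mat l)"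
      using assms(1) by (simp add: matrix_mult_diff mat_mult_mat)
    then have "mat (1 / l) ** A - mat 1 = (mat (1 / l) ** U) ** mat3 1 0 0 0 0 0 0 0 0 ** V"
      by (simp add: UV matrix_mul_assoc)
    then show "near_scalar (mat (1 / l) ** A) 1"
      unfolding near_scalar_def by blast
  qed
qed

lemma factorisation:
  fixes A :: "'a::{field, finite} ^ 3 ^ 3"
  assumes "det A = 1" and "\<And>k. A \<noteq> mat k"
  obtains z B C a' b' where "z ^ 3 = 1" "mat z ** A = B ** C" "char_data a b B"
    "(a', b') \<in> {(a, b), (b, a)}" "char_data a' b' C"
proof -
  note result = that
  \<comment> \<open>Transfers a factorisation of the normal form \<open>D\<close> back to
    \<open>mat z ** A\<close>.\<close>
  have lift: thesis if z: "z ^ 3 = 1" and A: "similar_mat (mat z ** A) D" "similar_mat D (B ** C)"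
    and B: "char_data a b B" and ab: "(a', b') \<in> {(a, b), (b, a)}" and C: "char_data a' b' C"
    for z D B C a' b'
  proof -
    obtain B' C' where "mat z ** A = B' ** C'" "similar_mat B' B" "similar_mat C' C"
      using similar_mat_mult[OF similar_mat_trans[OF A]] .
    then show thesis
      using result[OF z _ _ ab] B C char_data_similar by blast
  qed
  from assms show thesis
  proof (cases rule: nonscalar_normal_form)
    case 1
    then have A: "similar_mat (mat 1 ** A) (companion (trace A) (sum_minors A))"
      by simp
    show thesis
    proof (cases "a = b")
      case True
      obtain B where "char_data a a B"
        "similar_mat (companion (trace A) (sum_minors A)) (B ** companion a a)"
        using companion_factorisation_eq .
      then show thesis
        using lift[OF _ A _ _ _ char_data_companion[of a a]] True by simp
    next
      case False
      obtain B C a' b' where "char_data a b B" "(a', b') \<in> {(a, b), (b, a)}" "char_data a' b' C"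
        "similar_mat (companion (trace A) (sum_minors A)) (B ** C)"
        using companion_factorisation_neq[OF False] .
      then show thesis
        using lift[OF _ A] by simp
    qed
  next
    case (2 l)
    obtain z m where z: "z ^ 3 = 1" and m: "m \<noteq> 0" "m ^ 3 \<noteq> 1 \<or> m = 1"
      and A: "similar_mat (mat z ** A) (reflection_form m)"
    proof (cases "l ^ 3 = 1")
      case True
      then show thesis
        using mat_mult_reflection_form[OF 2(1) _ 2(2)] by (intro that[of "1 / l" 1])
          (simp_all add: power_divide)
    next
      case False
      then show thesis
        using 2 by (intro that[of 1 l]) simp_all
    qed
    obtain B C where "char_data a b B" "char_data a b C"
      "similar_mat (reflection_form m) (B ** C)"
      using reflection_form_factorisation[OF m] .
    then show thesis
      using lift[OF z A, of B C a b] by simp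
  qed
qed

subsection \<open>Matrices of order p\<close>

text \<open>The order of the quantifiers is the point: the coefficients come from reducing
  \<open>x^n\<close> modulo the common characteristic polynomial and serve all \<open>B\<close> at
  once.\<close>

lemma mpow_reduction:
  fixes a b :: "'a::field"
  shows "\<exists>\<alpha> \<beta> \<gamma>. \<forall>B. char_data a b B \<longrightarrow> mpow B n = mat \<alpha> ** (B ** B) + mat \<beta> ** B + mat \<gamma>"
proof (induction n)
  case 0
  show ?case
    by (rule exI[of _ 0], rule exI[of _ 0], rule exI[of _ 1]) simp
next
  case (Suc n)
  then obtain \<alpha> \<beta> \<gamma> where
    IH: "\<And>B. char_data a b B \<Longrightarrow> mpow B n = mat \<alpha> ** (B ** B) + mat \<beta> ** B + mat \<gamma>"
    by blast
  have "mpow B (Suc n) = mat (\<alpha> * a + \<beta>) ** (B ** B) + mat (\<gamma> - \<alpha> * b) ** B + mat \<alpha>"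
    if B: "char_data a b B" for B
  proof -
    have "mpow B (Suc n) = mat \<alpha> ** (B ** (B ** B)) + mat \<beta> ** (B ** B) + mat \<gamma> ** B"
      by (simp add: IH[OF B] matrix_mult_add matrix_mul_assoc)
    also have "B ** (B ** B) = mat a ** (B ** B) - mat b ** B + mat 1"
      using B cayley_hamilton_3[of B] by (simp add: char_data_def)
    finally show ?thesis
      by (simp add: vec_eq_iff matrix_mult_add matrix_mult_diff mat_mult_nth algebra_simps)
  qed
  then show ?case
    by blast
qed

text \<open>The first three powers \<open>1\<close>, \<open>K\<close>, \<open>K^2\<close> of a
  companion matrix are linearly independent, so the coefficients must be \<open>0\<close>,
  \<open>0\<close>, \<open>1\<close>.\<close>

lemma mpow_eq_1_of_companion:
  assumes "mpow (companion a b) n = mat 1" and "char_data a b B"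
  shows "mpow B n = mat 1"
proof -
  obtain \<alpha> \<beta> \<gamma> where
    red: "\<And>B. char_data a b B \<Longrightarrow> mpow B n = mat \<alpha> ** (B ** B) + mat \<beta> ** B + mat \<gamma>"
    using mpow_reduction by metis
  have "mat \<alpha> ** (companion a b ** companion a b) + mat \<beta> ** companion a b + mat \<gamma> = mat 1"
    using red[OF char_data_companion] assms(1) by simp
  then have "\<alpha> = 0" "\<beta> = 0" "\<gamma> = 1"
    by (simp_all add: companion_def mat3_simps)
  then show ?thesis
    using red[OF assms(2)] by simp
qed

text \<open>Inversion swaps trace and second coefficient when the determinant is one;
  \<open>D\<close> is the inverse of \<open>companion b a\<close>.\<close>

lemma mpow_companion_swap:
  assumes "mpow (companion a b) n = mat 1"
  shows "mpow (companion b a) n = mat 1"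
proof -
  define D where "D = mat3 a 1 0 (- b) 0 1 1 0 0"
  have "char_data a b D"
    by (simp add: D_def char_data_def mat3_simps)
  then have "mpow D n = mat 1"
    by (rule mpow_eq_1_of_companion[OF assms])
  moreover have DK: "D ** companion b a = mat 1" "companion b a ** D = mat 1"
    by (simp_all add: D_def companion_def mat3_simps)
  moreover have "mpow (D ** companion b a) n = mpow D n ** mpow (companion b a) n"
    using DK by (intro mpow_mult_commute) simp
  ultimately show ?thesis
    by (simp add: mpow_mat)
qed

text \<open>The matrix diag(1, x, 1/x) has \<open>p\<close>-th power one. As \<open>p\<close> is
  odd, \<open>x^2 \<noteq> 1\<close>, so its eigenvalues are distinct and it is cyclic.\<close>

lemma mpow_companion_root_of_unity:
  fixes x :: "'a::field"
  assumes "x \<noteq> 1" "x ^ p = 1" "odd p"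
  obtains a b :: 'a where "mpow (companion a b) p = mat 1"
proof -
  define X where "X = mat3 1 0 0 0 x 0 0 0 (1 / x)"
  have x0: "x \<noteq> 0"
    using assms odd_pos[of p] by (cases "x = 0") (auto simp: power_0_left)
  have xx: "x \<noteq> 1 / x"
  proof
    assume "x = 1 / x"
    then have "x ^ 2 = 1"
      using x0 by (simp add: power2_eq_square field_simps)
    moreover obtain k where "p = 2 * k + 1"
      using \<open>odd p\<close> oddE by blast
    ultimately show False
      using assms by (simp add: power_mult)
  qed
  have "mpow X n = mat3 1 0 0 0 (x ^ n) 0 0 0 (1 / x ^ n)" for n
    by (induction n) (simp_all add: X_def mat3_simps mult.commute)
  then have X: "mpow X p = mat 1"
    using assms(2) by (simp add: mat3_simps)
  have "similar_mat X (companion (trace X) (sum_minors X))"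
  proof (rule not_near_scalar_similar_companion)
    show "det X = 1"
      using x0 by (simp add: X_def mat3_simps)
    show "\<not> near_scalar X l" for l
    proof
      assume "near_scalar X l"
      then have "(1 - l) * (x - l) = 0" "(1 - l) * (1 / x - l) = 0" "(x - l) * (1 / x - l) = 0"
        unfolding X_def by (auto dest: near_scalar_minors)
      moreover have "1 / x \<noteq> 1"
        using assms(1) x0 by simp
      ultimately show False
        using assms(1) xx by (auto simp only: mult_eq_0_iff right_minus_eq)
    qed
  qed
  then have "similar_mat (mpow (companion (trace X) (sum_minors X)) p) (mat 1)"
    unfolding X[symmetric] by (rule similar_mat_mpow[OF similar_mat_sym])
  then show thesis
    by (rule that[OF similar_mat_mat])
qed

text \<open>A unipotent Jordan block has characteristic polynomial \<open>(x - 1)^3\<close>. Its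
  \<open>p\<close>-th power is \<open>1\<close> because the odd number \<open>p\<close> divides
  \<open>p choose 2\<close>.\<close>

lemma mpow_companion_char:
  assumes "odd p" "of_nat p = (0::'a::field)"
  shows "mpow (companion 3 (3::'a)) p = mat 1"
proof -
  define X :: "'a ^ 3 ^ 3" where "X = mat3 1 1 0 0 1 1 0 0 1"
  have pow: "mpow X n = mat3 1 (of_nat n) (of_nat (n choose 2)) 0 1 (of_nat n) 0 0 1" for n
    by (induction n) (simp_all add: X_def mat3_simps numeral_2_eq_2 add.commute)
  obtain k where "p = 2 * k + 1"
    using \<open>odd p\<close> oddE by blast
  then have "p choose 2 = p * k"
    by (simp add: choose_two)
  then have "of_nat (p choose 2) = (0::'a)"
    by (simp add: assms)
  then have X: "mpow X p = mat 1"
    by (simp add: pow assms(2) mat3_simps)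
  have "similar_mat X (companion (trace X) (sum_minors X))"
  proof (rule not_near_scalar_similar_companion)
    show "det X = 1"
      by (simp add: X_def mat3_simps)
    show "\<not> near_scalar X l" for l
      unfolding X_def by (auto dest: near_scalar_minors(7))
  qed
  moreover have "trace X = 3" "sum_minors X = 3"
    by (simp_all add: X_def mat3_simps)
  ultimately have "similar_mat (mpow (companion 3 3) p) (mpow X p)"
    using similar_mat_mpow similar_mat_sym by metis
  then show ?thesis
    unfolding X by (rule similar_mat_mat)
qed

text \<open>Nontrivial \<open>p\<close>-th roots of unity settle the claim. Otherwise
  \<open>X\<close> is rescaled to have \<open>p\<close>-th power one; it is then cyclic, or a
  transvection, which forces \<open>p = 0\<close> in the field.\<close>

lemma mpow_companion_exists:
  fixes X :: "'a::field ^ 3 ^ 3"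
  assumes p: "prime p" "odd p" and X: "det X = 1" "\<And>k. X \<noteq> mat k" "mpow X p = mat k"
  obtains a b :: 'a where "mpow (companion a b) p = mat 1"
proof (cases "\<exists>x::'a. x \<noteq> 1 \<and> x ^ p = 1")
  case True
  then show thesis
    using mpow_companion_root_of_unity p(2) that by blast
next
  case no_root: False
  have det_mpow: "det (mpow X n) = 1" for n
    by (induction n) (simp_all add: det_mul X(1))
  have k3: "k ^ 3 = 1"
    using det_mpow[of p] by (simp add: X(3) mat3_simps power3_eq_cube)
  \<comment> \<open>The \<open>p\<close>-th power of \<open>k^j X\<close> is
    \<open>k^(j p + 1)\<close>, so by \<open>k^3 = 1\<close> it is enough that 3 divides
    \<open>j p + 1\<close>. For \<open>p = 3\<close> the scalar \<open>k\<close> is already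
    \<open>1\<close>.\<close>
  have "\<exists>j. k ^ (j * p + 1) = 1"
  proof (cases "p = 3")
    case True
    then have "k = 1"
      using no_root k3 by blast
    then show ?thesis
      by simp
  next
    case False
    then have "\<not> 3 dvd p"
      using primes_dvd_imp_eq[of 3 p] p(1) by auto
    then have "3 dvd 2 * p + 1 \<or> 3 dvd 1 * p + 1"
      by presburger
    then obtain j t where "j * p + 1 = 3 * t"
      by (metis dvdE)
    then have "k ^ (j * p + 1) = 1"
      by (simp only: power_mult k3 power_one)
    then show ?thesis
      by blast
  qed
  then obtain j where j: "k ^ (j * p + 1) = 1"
    by blast
  define Y where "Y = mat (k ^ j) ** X"
  have kj3: "(k ^ j) ^ 3 = 1"
    by (metis k3 power_mult mult.commute power_one)
  have k0: "k \<noteq> 0"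
    using k3 by auto
  have "mpow Y p = mat ((k ^ j) ^ p) ** mat k"
    unfolding Y_def by (simp add: mpow_mult_commute[OF mat_commute] mpow_mat X(3))
  then have Yp: "mpow Y p = mat 1"
    using j by (simp add: mat_mult_mat power_mult mult.commute)
  have "det Y = 1"
    using kj3 by (simp add: Y_def det_mul X(1)) (simp add: mat3_simps power3_eq_cube)
  moreover have "Y \<noteq> mat l" for l
  proof
    assume "Y = mat l"
    then have "mat (1 / k ^ j) ** Y = mat (1 / k ^ j) ** mat l"
      by simp
    then have "X = mat (1 / k ^ j * l)"
      using k0 by (simp add: Y_def matrix_mul_assoc mat_mult_mat)
    then show False
      using X(2) by blast
  qed
  ultimately show thesis
  proof (cases rule: nonscalar_normal_form)
    case 1
    then have "similar_mat (mpow (companion (trace Y) (sum_minors Y)) p) (mat 1)"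
      unfolding Yp[symmetric] by (rule similar_mat_mpow[OF similar_mat_sym])
    then show thesis
      by (rule that[OF similar_mat_mat])
  next
    case (2 l)
    then have "similar_mat (mpow (reflection_form l) p) (mat 1)"
      unfolding Yp[symmetric] by (intro similar_mat_mpow[OF similar_mat_sym])
    then have R: "mpow (reflection_form l) p = mat 1"
      by (rule similar_mat_mat)
    have "\<exists>a b c d. mpow (reflection_form l) n = mat3 a b 0 c d 0 0 0 (l ^ n)" for n
    proof (induction n)
      case (Suc n)
      then show ?case
        by (auto simp: reflection_form_def mat3_simps)
    qed (auto simp: mat3_simps)
    then obtain a b c d where "mpow (reflection_form l) p = mat3 a b 0 c d 0 0 0 (l ^ p)"
      by blast
    then have "l ^ p = 1"
      by (simp add: R mat3_simps)
    then have l: "l = 1"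
      using no_root by blast
    have "mpow (reflection_form 1) n =
        mat3 (1 - of_nat n) (- of_nat n) 0 (of_nat n) (1 + of_nat n) 0 0 0 (1::'a)" for n
      by (induction n) (simp_all add: reflection_form_def mat3_simps algebra_simps)
    then have "of_nat p = (0::'a)"
      using R by (simp add: l mat3_simps)
    then show thesis
      using mpow_companion_char[OF p(2)] that by blast
  qed
qed

subsection \<open>The projective special linear group\<close>

lemma carrier_SL_iff: "A \<in> carrier SL \<longleftrightarrow> det A = 1"
  by (simp add: SL_def)

lemma mult_SL: "A \<otimes>\<^bsub>SL\<^esub> B = A ** B"
  by (simp add: SL_def)

lemma nat_pow_SL: "A [^]\<^bsub>SL\<^esub> (n::nat) = mpow A n"
  by (induction n) (simp_all add: SL_def)

text \<open>Commuting with one transvection and one cyclic permutation matrix already makes a matrix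
  scalar.\<close>

lemma mem_center_SL_iff:
  fixes A :: "'a::field ^ 3 ^ 3"
  shows "A \<in> group_center SL \<longleftrightarrow> det A = 1 \<and> (\<exists>k. A = mat k)"
proof
  assume A: "A \<in> group_center SL"
  then have comm: "A ** B = B ** A" if "det B = 1" for B
    using that by (simp add: group_center_def carrier_SL_iff mult_SL)
  obtain a b c d e f g h i where a: "A = mat3 a b c d e f g h i"
    using mat3_exhaust by blast
  have "A ** mat3 1 1 0 0 1 0 0 0 1 = mat3 1 1 0 0 1 0 0 0 1 ** A"
    by (rule comm) (simp add: mat3_simps)
  then have "d = 0" "g = 0" "f = 0" "a = e"
    by (simp_all add: a mat3_simps)
  moreover have "A ** mat3 0 1 0 0 0 1 1 0 0 = mat3 0 1 0 0 0 1 1 0 0 ** A"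
    by (rule comm) (simp add: mat3_simps)
  from this[unfolded a mat3_simps, simplified] have "b = f" "c = d" "h = d" "e = i"
    by blast+
  ultimately have "A = mat a"
    by (simp add: a mat3_simps)
  with A show "det A = 1 \<and> (\<exists>k. A = mat k)"
    by (auto simp: group_center_def carrier_SL_iff)
next
  assume "det A = 1 \<and> (\<exists>k. A = mat k)"
  then show "A \<in> group_center SL"
    by (auto simp: group_center_def carrier_SL_iff mult_SL mat_commute)
qed

definition PSL_class :: "'a::field ^ 'n ^ 'n \<Rightarrow> ('a ^ 'n ^ 'n) set" where
  "PSL_class A = group_center SL #>\<^bsub>SL\<^esub> A"

lemma PSL_class_hom: "PSL_class \<in> hom SL PSL"
proof -
  have "(\<lambda>A. group_center SL #>\<^bsub>SL\<^esub> A) \<in> hom SL PSL"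
    unfolding PSL_def
    by (intro normal.r_coset_hom_Mod group.group_center_normal group_SL)
  then show ?thesis
    by (simp add: PSL_class_def[abs_def])
qed

lemma carrier_PSL: "carrier PSL = PSL_class ` {A. det A = 1}"
  by (simp add: PSL_def carrier_FactGroup PSL_class_def[abs_def] SL_def)

lemma PSL_class_mult:
  "det A = 1 \<Longrightarrow> det B = 1 \<Longrightarrow> PSL_class (A ** B) = PSL_class A \<otimes>\<^bsub>PSL\<^esub> PSL_class B"
  using hom_mult[OF PSL_class_hom] by (simp add: carrier_SL_iff mult_SL)

lemma PSL_class_pow: "det A = 1 \<Longrightarrow> PSL_class A [^]\<^bsub>PSL\<^esub> (n::nat) = PSL_class (mpow A n)"
  using hom_nat_pow[OF PSL_class_hom _ group_SL group_PSL, of A n]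
  by (simp add: carrier_SL_iff nat_pow_SL)

lemma PSL_class_eq_one_iff:
  fixes A :: "'a::field ^ 3 ^ 3"
  assumes "det A = 1"
  shows "PSL_class A = \<one>\<^bsub>PSL\<^esub> \<longleftrightarrow> (\<exists>k. A = mat k)"
proof -
  have sub: "subgroup (group_center SL) (SL :: ('a ^ 3 ^ 3) monoid)"
    by (intro normal_imp_subgroup group.group_center_normal group_SL)
  have "PSL_class A = \<one>\<^bsub>PSL\<^esub> \<longleftrightarrow> A \<in> group_center SL"
    using group.coset_join1[OF group_SL _ _ sub] group.coset_join2[OF group_SL _ sub] assms
    by (auto simp: PSL_class_def PSL_def carrier_SL_iff)
  then show ?thesis
    using assms by (simp add: mem_center_SL_iff)
qed

text \<open>Sylow's theorem, applied to the exponent one, gives a subgroup of order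
  \<open>p\<close>; any nontrivial element of it will do.\<close>

lemma (in group) cauchy:
  assumes "finite (carrier G)" "prime p" "p dvd card (carrier G)"
  obtains x where "x \<in> carrier G" "x \<noteq> \<one>" "x [^] p = \<one>"
proof -
  obtain m where "order G = p ^ 1 * m"
    using assms(3) by (auto simp: order_def)
  then obtain H where H: "subgroup H G" "card H = p"
    using sylow_thm[OF assms(2) is_group _ assms(1)] by fastforce
  have "H \<noteq> {\<one>}"
    using H(2) assms(2) by auto
  then obtain x where x: "x \<in> H" "x \<noteq> \<one>"
    using subgroup.one_closed[OF H(1)] by blast
  interpret H: group "G\<lparr>carrier := H\<rparr>"
    by (rule subgroup_imp_group[OF H(1)])
  have "x [^]\<^bsub>G\<lparr>carrier := H\<rparr>\<^esub> order (G\<lparr>carrier := H\<rparr>) = \<one>\<^bsub>G\<lparr>carrier := H\<rparr>\<^esub>"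
    by (rule H.pow_order_eq_1) (simp add: x)
  then have "x [^] p = \<one>"
    by (simp add: order_def H(2) flip: nat_pow_consistent)
  with x show thesis
    using that subgroup.mem_carrier[OF H(1)] by blast
qed

lemma (in group) mem_elements_of_order_iff:
  assumes "prime p"
  shows "x \<in> elements_of_order p G \<longleftrightarrow> x \<in> carrier G \<and> x \<noteq> \<one> \<and> x [^] p = \<one>"
proof -
  have "ord x = p \<longleftrightarrow> x \<noteq> \<one> \<and> x [^] p = \<one>" if x: "x \<in> carrier G"
  proof
    assume "ord x = p"
    then show "x \<noteq> \<one> \<and> x [^] p = \<one>"
      using x assms ord_eq_1[OF x] pow_eq_id[OF x, of p] by auto
  next
    assume "x \<noteq> \<one> \<and> x [^] p = \<one>"
    then have "ord x dvd p" "ord x \<noteq> 1"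
      using ord_eq_1[OF x] pow_eq_id[OF x] by auto
    then show "ord x = p"
      using assms by (meson prime_nat_iff)
  qed
  then show ?thesis
    by (auto simp: elements_of_order_def)
qed

lemma (in group) p_width_eq_2I:
  assumes p: "prime p" "odd p"
    and two: "\<And>g. g \<in> carrier G \<Longrightarrow> g \<noteq> \<one> \<Longrightarrow>
      \<exists>x\<in>carrier G. \<exists>y\<in>carrier G. x [^] p = \<one> \<and> y [^] p = \<one> \<and> g = x \<otimes> y"
    and inv: "t \<in> carrier G" "t \<noteq> \<one>" "t [^] (2::nat) = \<one>"
  shows "p_width p G = 2"
proof -
  define W where "W k \<longleftrightarrow> (\<forall>g\<in>carrier G. \<exists>xs. set xs \<subseteq> elements_of_order p G \<and>
    length xs \<le> k \<and> group_prod G xs = g)" for k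
  have W2: "W 2"
    unfolding W_def
  proof
    fix g assume g: "g \<in> carrier G"
    show "\<exists>xs. set xs \<subseteq> elements_of_order p G \<and> length xs \<le> 2 \<and> group_prod G xs = g"
    proof (cases "g = \<one>")
      case True
      then show ?thesis
        by (intro exI[of _ "[]"]) (simp add: group_prod_def)
    next
      case False
      then obtain x y where xy: "x \<in> carrier G" "y \<in> carrier G" "x [^] p = \<one>" "y [^] p = \<one>"
        "g = x \<otimes> y"
        using two[OF g] by blast
      then show ?thesis
        \<comment> \<open>A factor may be the identity, which does not have order \<open>p\<close>;
          it is dropped from the product.\<close>
        by (intro exI[of _ "filter (\<lambda>z. z \<noteq> \<one>) [x, y]"])
          (auto simp: group_prod_def mem_elements_of_order_iff[OF p(1)])
    qed
  qed
  have ge2: "2 \<le> k" if "W k" for k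
  proof (rule ccontr)
    assume "\<not> 2 \<le> k"
    then obtain xs where xs: "set xs \<subseteq> elements_of_order p G" "length xs \<le> 1" "group_prod G xs = t"
      using \<open>W k\<close> inv(1) unfolding W_def by force
    \<comment> \<open>A product of at most one element of order \<open>p\<close> could equal the
      involution \<open>t\<close> only if \<open>t\<close> itself had order
      \<open>p\<close>.\<close>
    then have "xs = [t]"
      using inv(2) by (cases xs) (auto simp: group_prod_def elements_of_order_def)
    then have "ord t = p"
      using xs(1) by (simp add: elements_of_order_def)
    then have "p dvd 2"
      using inv by (simp add: pow_eq_id)
    then show False
      using p primes_dvd_imp_eq[of p 2] by auto
  qed
  have "Inf {enat k | k. W k} = enat 2"
    using W2 ge2 by (intro antisym Inf_lower Inf_greatest) auto
  then show ?thesis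
    by (simp add: p_width_def W_def numeral_eq_enat)
qed

theorem proposition3p6:
  fixes G :: "('a::{field, finite} ^ 3 ^ 3) set monoid" and q p :: nat
  assumes "CARD('a) = q"
    and "G = PSL"
    and "prime p" and "odd p" and "p dvd card (carrier G)"
  shows "p_width p G = 2"
proof -
  have G: "group G"
    unfolding \<open>G = PSL\<close> by (rule group_PSL)
  obtain x where "x \<in> carrier G" "x \<noteq> \<one>\<^bsub>G\<^esub>" "x [^]\<^bsub>G\<^esub> p = \<one>\<^bsub>G\<^esub>"
    using group.cauchy[OF G _ \<open>prime p\<close> \<open>p dvd card (carrier G)\<close>] by auto
  then obtain X :: "'a ^ 3 ^ 3" where X: "det X = 1" "PSL_class X \<noteq> \<one>\<^bsub>PSL\<^esub>"
    "PSL_class X [^]\<^bsub>PSL\<^esub> p = \<one>\<^bsub>PSL\<^esub>"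
    unfolding \<open>G = PSL\<close> carrier_PSL by blast
  have det_mpow: "det (mpow X n) = 1" for n
    by (induction n) (simp_all add: det_mul X(1))
  obtain k where "mpow X p = mat k"
    using X(3) by (auto simp: PSL_class_pow X(1) PSL_class_eq_one_iff det_mpow)
  moreover have "X \<noteq> mat k" for k
    using X(2) by (auto simp: PSL_class_eq_one_iff X(1))
  ultimately obtain a b :: 'a where ab: "mpow (companion a b) p = mat 1"
    using mpow_companion_exists[OF \<open>prime p\<close> \<open>odd p\<close> X(1)] by blast
  show ?thesis
  proof (rule group.p_width_eq_2I[OF G \<open>prime p\<close> \<open>odd p\<close>])
    fix g assume "g \<in> carrier G" "g \<noteq> \<one>\<^bsub>G\<^esub>"
    then obtain A :: "'a ^ 3 ^ 3" where A: "det A = 1" "g = PSL_class A" "PSL_class A \<noteq> \<one>\<^bsub>PSL\<^esub>"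
      unfolding \<open>G = PSL\<close> carrier_PSL by blast
    then have "A \<noteq> mat k" for k
      by (auto simp: PSL_class_eq_one_iff)
    from factorisation[OF A(1) this, of a b] obtain z B C a' b' where z: "z ^ 3 = 1"
      and BC: "mat z ** A = B ** C" and B: "char_data a b B"
      and ab': "(a', b') \<in> {(a, b), (b, a)}" and C: "char_data a' b' C" .
    have detz: "det (mat z :: 'a ^ 3 ^ 3) = 1"
      using z by (simp add: mat3_simps power3_eq_cube)
    then have "PSL_class (mat z :: 'a ^ 3 ^ 3) = \<one>\<^bsub>PSL\<^esub>"
      by (auto simp: PSL_class_eq_one_iff)
    moreover have "PSL_class A \<in> carrier PSL"
      using A(1) by (simp add: carrier_PSL)
    ultimately have "PSL_class (mat z ** A) = g"
      by (simp add: PSL_class_mult detz A(1,2) group.is_monoid[OF group_PSL] monoid.l_one)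
    moreover have det: "det B = 1" "det C = 1"
      using B C by (simp_all add: char_data_def)
    ultimately have g: "g = PSL_class B \<otimes>\<^bsub>G\<^esub> PSL_class C"
      by (simp add: BC PSL_class_mult \<open>G = PSL\<close>)
    have one: "PSL_class (mat 1 :: 'a ^ 3 ^ 3) = \<one>\<^bsub>PSL\<^esub>"
      by (subst PSL_class_eq_one_iff) auto
    have "mpow B p = mat 1"
      by (rule mpow_eq_1_of_companion[OF ab B])
    moreover have "mpow C p = mat 1"
      using ab' C ab mpow_companion_swap[OF ab] mpow_eq_1_of_companion by blast
    ultimately have "PSL_class B [^]\<^bsub>G\<^esub> p = \<one>\<^bsub>G\<^esub>" "PSL_class C [^]\<^bsub>G\<^esub> p = \<one>\<^bsub>G\<^esub>"
      by (simp_all add: \<open>G = PSL\<close> PSL_class_pow det one)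
    moreover have "PSL_class B \<in> carrier G" "PSL_class C \<in> carrier G"
      using det by (simp_all add: \<open>G = PSL\<close> carrier_PSL)
    ultimately show "\<exists>x\<in>carrier G. \<exists>y\<in>carrier G.
        x [^]\<^bsub>G\<^esub> p = \<one>\<^bsub>G\<^esub> \<and> y [^]\<^bsub>G\<^esub> p = \<one>\<^bsub>G\<^esub> \<and> g = x \<otimes>\<^bsub>G\<^esub> y"
      using g by blast
  next
    \<comment> \<open>A transposition matrix with the sign corrected to determinant one; it is
      nonscalar in characteristic two as well.\<close>
    define T :: "'a ^ 3 ^ 3" where "T = mat3 0 1 0 1 0 0 0 0 (- 1)"
    have T: "det T = 1" "mpow T 2 = mat 1" "T \<noteq> mat k" for k
      by (simp_all add: T_def mat3_simps numeral_2_eq_2)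
    show "PSL_class T \<in> carrier G"
      using T by (simp add: \<open>G = PSL\<close> carrier_PSL)
    show "PSL_class T \<noteq> \<one>\<^bsub>G\<^esub>"
      using T by (simp add: \<open>G = PSL\<close> PSL_class_eq_one_iff)
    show "PSL_class T [^]\<^bsub>G\<^esub> (2::nat) = \<one>\<^bsub>G\<^esub>"
      using T by (auto simp: \<open>G = PSL\<close> PSL_class_pow PSL_class_eq_one_iff)
  qed
qed

end
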